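(* Consider the twelve axiom schemata DP, HE, CD, GLPOA, GMP, LEM, GLPO, DGP, DNSU, WGMP, DNSE, WLEM (defined in the context). For schemata $S,T$ among these, $S \supset T$ (every instance of $T$ is derivable in minimal first-order logic extended by all instances of $S$) holds if and only if $(S,T)$ belongs to the reflexive transitive closure of the following relation: \[ \begin{aligned} &\mathrm{LEM}\to\mathrm{GLPO},\quad \mathrm{GLPO}\to\mathrm{LEM},\quad \mathrm{DNSU}\to\mathrm{WGMP},\quad \mathrm{WGMP}\to\mathrm{DNSU},\\ &\mathrm{DP}\to\mathrm{GMP},\quad \mathrm{DP}\to\mathrm{CD},\quad \mathrm{GLPOA}\to\mathrm{GMP},\quad \mathrm{GLPOA}\to\mathrm{LEM},\\ &\mathrm{GMP}\to\mathrm{DNSE},\quad \mathrm{GMP}\to\mathrm{DNSU},\quad \mathrm{HE}\to\mathrm{DNSE},\quad \mathrm{LEM}\to\mathrm{DNSE},\\ &\mathrm{LEM}\to\mathrm{WLEM},\quad \mathrm{DGP}\to\mathrm{WLEM}. \end{aligned} \]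
   Context: Fix a first-order language (without equality) with countably many relation symbols of each arity, nullary ones (propositional symbols) included. Minimal logic is first-order natural deduction with the introduction and elimination rules for $\to,\wedge,\vee,\forall,\exists$, in which $\bot$ is a propositional constant with no special rule, and $\lnot A := A \to \bot$. Domains are nonempty. For schemata $S_0,\dots,S_n$, minimal logic extended by $S_0,\dots,S_n$ is obtained by adding, for every formula instance of each $S_i$ (possibly containing free variables), a premise-free deduction rule concluding that instance; in particular $\forall$-introduction may be applied to free variables of such instances. We write $S_0,\dots,S_n \supset T$ if every instance of the scheme $T$ is derivable in this system. Schemata, where $A,B,Q$ range over arbitrary formulas, $Px$ ranges over arbitrary formulas (in which $x$ may occur free, possibly with other free variables), and $Py$ denotes $Px$ with $y$ substituted for $x$ (with $y$ fresh): - $\mathrm{LEM}(A) := A \vee \lnot A$ - $\mathrm{WLEM}(A) := \lnot A \vee \lnot\lnot A$ - $\mathrm{DGP}(A,B) := (A\to B)\vee(B\to A)$ - $\mathrm{DP}(Px) := \exists y\,(Py \to \forall x\, Px)$ - $\mathrm{HE}(Px) := \exists y\,(\exists x\, Px \to Py)$ - $\mathrm{GMP}(Px) := \lnot\forall x\, Px \to \exists x\,\lnot Px$ - $\mathrm{WGMP}(Px) := \lnot\forall x\, Px \to \lnot\lnot\exists x\,\lnot Px$ - $\mathrm{GLPO}(Px) := \forall x\,\lnot Px \vee \exists x\, Px$ - $\mathrm{GLPOA}(Px) := \forall x\, Px \vee \exists x\,\lnot Px$ - $\mathrm{DNSU}(Px) := \forall x\,\lnot\lnot Px \to \lnot\lnot\forall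 x\, Px$ - $\mathrm{DNSE}(Px) := \lnot\lnot\exists x\, Px \to \exists x\,\lnot\lnot Px$ - $\mathrm{CD}(Px,Q) := \forall x\,(Px \vee \exists x\, Q) \to (\forall x\, Px \vee \exists x\, Q)$ *)

theory Defs
  imports Main
begin

text \<open>
  Formulas are in de Bruijn style, hence identified up to renaming of bound variables.  The language
  has no function symbols, so terms are just variables, i.e. indices.  In \<open>Rel r xs\<close> the
  relation symbol is the pair of \<open>r\<close> and the arity \<open>length xs\<close>, which gives countably
  many symbols of each arity, including the propositional ones \<open>Rel r []\<close>.
\<close>

datatype form =
    Rel nat "nat list"
  | Bot  ("\<^bold>\<bottom>")
  | Imp form form  (infixr "\<^bold>\<rightarrow>" 55)
  | Or form form  (infixr "\<^bold>\<or>" 60)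
  | And form form  (infixr "\<^bold>\<and>" 65)
  | All form  ("\<^bold>\<forall>_" [70] 70)
  | Ex form  ("\<^bold>\<exists>_" [70] 70)

abbreviation Neg :: "form \<Rightarrow> form"  ("\<^bold>\<not>_" [70] 70)
  where "\<^bold>\<not>A \<equiv> A \<^bold>\<rightarrow> \<^bold>\<bottom>"

text \<open>Capture-avoiding substitution of variables for variables.\<close>

primrec up :: "(nat \<Rightarrow> nat) \<Rightarrow> nat \<Rightarrow> nat" where
  "up f 0 = 0"
| "up f (Suc n) = Suc (f n)"

primrec ren :: "(nat \<Rightarrow> nat) \<Rightarrow> form \<Rightarrow> form" where
  "ren f (Rel r xs) = Rel r (map f xs)"
| "ren f \<^bold>\<bottom> = \<^bold>\<bottom>"
| "ren f (A \<^bold>\<rightarrow> B) = (ren f A \<^bold>\<rightarrow> ren f B)"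
| "ren f (A \<^bold>\<or> B) = (ren f A \<^bold>\<or> ren f B)"
| "ren f (A \<^bold>\<and> B) = (ren f A \<^bold>\<and> ren f B)"
| "ren f (\<^bold>\<forall>A) = \<^bold>\<forall>(ren (up f) A)"
| "ren f (\<^bold>\<exists>A) = \<^bold>\<exists>(ren (up f) A)"

text \<open>
  \<open>lift A\<close> is \<open>A\<close> read under one more binder, whose variable (index 0) is thus not free
  in it; \<open>inst A t\<close> replaces index 0 by the variable \<open>t\<close> and removes the binder.
\<close>

definition lift :: "form \<Rightarrow> form" where
  "lift = ren Suc"

definition inst :: "form \<Rightarrow> nat \<Rightarrow> form" where
  "inst A t = ren (case_nat t id) A"

text \<open>
  Natural deduction for minimal logic, with a set \<open>Ax\<close> of formulas as additional premise-free
  rules.  The eigenvariable conditions are expressed by lifting the open assumptions (and, for the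
  existential elimination, the conclusion), but not \<open>Ax\<close>: free variables of axioms may be
  generalized.
\<close>

inductive deriv :: "form set \<Rightarrow> form set \<Rightarrow> form \<Rightarrow> bool"  ("_ \<parallel> _ \<turnstile> _" [51, 51, 51] 50)
  for Ax :: "form set" where
  Axiom: "A \<in> Ax \<Longrightarrow> Ax \<parallel> \<Gamma> \<turnstile> A"
| Assm: "A \<in> \<Gamma> \<Longrightarrow> Ax \<parallel> \<Gamma> \<turnstile> A"
| ImpI: "Ax \<parallel> insert A \<Gamma> \<turnstile> B \<Longrightarrow> Ax \<parallel> \<Gamma> \<turnstile> A \<^bold>\<rightarrow> B"
| ImpE: "Ax \<parallel> \<Gamma> \<turnstile> A \<^bold>\<rightarrow> B \<Longrightarrow> Ax \<parallel> \<Gamma> \<turnstile> A \<Longrightarrow> Ax \<parallel> \<Gamma> \<turnstile> B"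
| AndI: "Ax \<parallel> \<Gamma> \<turnstile> A \<Longrightarrow> Ax \<parallel> \<Gamma> \<turnstile> B \<Longrightarrow> Ax \<parallel> \<Gamma> \<turnstile> A \<^bold>\<and> B"
| AndE1: "Ax \<parallel> \<Gamma> \<turnstile> A \<^bold>\<and> B \<Longrightarrow> Ax \<parallel> \<Gamma> \<turnstile> A"
| AndE2: "Ax \<parallel> \<Gamma> \<turnstile> A \<^bold>\<and> B \<Longrightarrow> Ax \<parallel> \<Gamma> \<turnstile> B"
| OrI1: "Ax \<parallel> \<Gamma> \<turnstile> A \<Longrightarrow> Ax \<parallel> \<Gamma> \<turnstile> A \<^bold>\<or> B"
| OrI2: "Ax \<parallel> \<Gamma> \<turnstile> B \<Longrightarrow> Ax \<parallel> \<Gamma> \<turnstile> A \<^bold>\<or> B"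
| OrE: "Ax \<parallel> \<Gamma> \<turnstile> A \<^bold>\<or> B \<Longrightarrow> Ax \<parallel> insert A \<Gamma> \<turnstile> C \<Longrightarrow> Ax \<parallel> insert B \<Gamma> \<turnstile> C \<Longrightarrow> Ax \<parallel> \<Gamma> \<turnstile> C"
| AllI: "Ax \<parallel> lift ` \<Gamma> \<turnstile> A \<Longrightarrow> Ax \<parallel> \<Gamma> \<turnstile> \<^bold>\<forall>A"
| AllE: "Ax \<parallel> \<Gamma> \<turnstile> \<^bold>\<forall>A \<Longrightarrow> Ax \<parallel> \<Gamma> \<turnstile> inst A t"
| ExI: "Ax \<parallel> \<Gamma> \<turnstile> inst A t \<Longrightarrow> Ax \<parallel> \<Gamma> \<turnstile> \<^bold>\<exists>A"
| ExE: "Ax \<parallel> \<Gamma> \<turnstile> \<^bold>\<exists>A \<Longrightarrow> Ax \<parallel> insert A (lift ` \<Gamma>) \<turnstile> lift C \<Longrightarrow> Ax \<parallel> \<Gamma> \<turnstile> C"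

datatype scheme = DP | HE | CD | GLPOA | GMP | LEM | GLPO | DGP | DNSU | WGMP | DNSE | WLEM

text \<open>
  A formula \<open>P\<close> directly below a quantifier is \<open>Px\<close> with index 0 for \<open>x\<close>, and
  equally \<open>Py\<close> if that quantifier binds \<open>y\<close>.  So \<open>\<^bold>\<exists>(P \<^bold>\<rightarrow> lift (\<^bold>\<forall>P))\<close> is
  \<open>\<exists>y (Py \<rightarrow> \<forall>x Px)\<close>.
\<close>

primrec instances :: "scheme \<Rightarrow> form set" where
  "instances DP = {\<^bold>\<exists>(P \<^bold>\<rightarrow> lift (\<^bold>\<forall>P)) | P. True}"
| "instances HE = {\<^bold>\<exists>(lift (\<^bold>\<exists>P) \<^bold>\<rightarrow> P) | P. True}"
| "instances CD = {\<^bold>\<forall>(P \<^bold>\<or> lift (\<^bold>\<exists>Q)) \<^bold>\<rightarrow> (\<^bold>\<forall>P \<^bold>\<or> \<^bold>\<exists>Q) | P Q. True}"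
| "instances GLPOA = {\<^bold>\<forall>P \<^bold>\<or> \<^bold>\<exists>(\<^bold>\<not>P) | P. True}"
| "instances GMP = {\<^bold>\<not>(\<^bold>\<forall>P) \<^bold>\<rightarrow> \<^bold>\<exists>(\<^bold>\<not>P) | P. True}"
| "instances LEM = {A \<^bold>\<or> \<^bold>\<not>A | A. True}"
| "instances GLPO = {\<^bold>\<forall>(\<^bold>\<not>P) \<^bold>\<or> \<^bold>\<exists>P | P. True}"
| "instances DGP = {(A \<^bold>\<rightarrow> B) \<^bold>\<or> (B \<^bold>\<rightarrow> A) | A B. True}"
| "instances DNSU = {\<^bold>\<forall>(\<^bold>\<not>(\<^bold>\<not>P)) \<^bold>\<rightarrow> \<^bold>\<not>(\<^bold>\<not>(\<^bold>\<forall>P)) | P. True}"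
| "instances WGMP = {\<^bold>\<not>(\<^bold>\<forall>P) \<^bold>\<rightarrow> \<^bold>\<not>(\<^bold>\<not>(\<^bold>\<exists>(\<^bold>\<not>P))) | P. True}"
| "instances DNSE = {\<^bold>\<not>(\<^bold>\<not>(\<^bold>\<exists>P)) \<^bold>\<rightarrow> \<^bold>\<exists>(\<^bold>\<not>(\<^bold>\<not>P)) | P. True}"
| "instances WLEM = {\<^bold>\<not>A \<^bold>\<or> \<^bold>\<not>(\<^bold>\<not>A) | A. True}"

definition yields :: "scheme set \<Rightarrow> scheme \<Rightarrow> bool" where
  "yields Ss T \<longleftrightarrow> (\<forall>A \<in> instances T. (\<Union>S\<in>Ss. instances S) \<parallel> {} \<turnstile> A)"

end

theory Submission
  imports Defs "HOL-Analysis.Abstract_Topology"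
begin

text \<open>
  Each arrow of the relation is a short natural deduction, and derivations compose because derivable
  formulas may be added as axioms (\<open>deriv_cut_axioms\<close>).  All the work is in the converse, where
  every pair outside the closure needs a model.

  Formulas are interpreted by open sets of a topological space, with implication and universal
  quantification cut down to interiors.  An individual \<open>d\<close> exists on an open set \<open>E d\<close>, which gives
  Kripke models with growing domains as a special case, and falsum is an arbitrary open set \<open>F\<close>.
  A schema that holds for all families of open sets holds for all formulas, so \<open>soundness\<close> reduces
  the non-derivability of \<open>T\<close> from \<open>S\<close> to the validity of \<open>S\<close> for all families and
  the failure of \<open>T\<close> for one.

  The freedom in \<open>F\<close> is what is peculiar to minimal logic.  If falsum is true everywhere, then
  GLPOA and all that follows from it hold trivially, while the positive schemata DP, HE, CD and DGP
  can still fail.  If falsum is true everywhere except at one closed point,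
  then LEM holds, while at this point \<open>\<forall>x (Px \<or> \<bottom>)\<close> need not imply \<open>\<forall>x Px\<close>, and
  DNSU can fail.

  Fifteen separations generate all the others (\<open>edges_rtrancl_or_separated\<close>).  They use the following
  spaces.
  \<^item> The fork, a root below two leaves.  With a single individual DP and HE are trivial and WLEM
    fails; with two individuals, each having the property \<open>P\<close> at one leaf only, DNSE fails although
    CD and DNSU hold; with falsum true everywhere GLPOA holds, but HE and DGP fail.
  \<^item> Linear Kripke frames with infinitely many worlds and individuals.  DP asks for an individual that
    acquires \<open>P\<close> last and HE for one that acquires it first; if the worlds after the root have a last
    element but no first one, only DP holds.  In an ascending sequence of worlds every individual
    can acquire \<open>P\<close> eventually without all of them having it at any world, so that DNSU fails.
  \<^item> Two worlds with a second individual that appears, together with its property \<open>P\<close>, at the later one.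
    DGP holds since the frame is linear, and DNSE fails.
  \<^item> The spire, an ascending sequence of worlds whose final segments are, together with a limit point,
    the neighbourhoods of this point.  Every family of open sets attains its union locally, hence HE
    and DGP hold.  But the neighbourhoods of the limit point have an intersection with empty interior,
    which refutes CD, and, for a suitable falsum, DNSU.

  The last space is not a Kripke frame, for a reason.  Over a constant domain every Kripke frame
  validates CD (\<open>valid_CD_up_topology\<close>), and a frame where an individual appears
  only after some world refutes HE at this world: the newcomer may be the only one that ever has
  \<open>P\<close>.
\<close>

section \<open>Derivations\<close>

lemma up_comp: "up f \<circ> up g = up (f \<circ> g)"
proof
  show "(up f \<circ> up g) n = up (f \<circ> g) n" for n by (cases n) auto
qed

lemma up_id: "up id = id"
proof
  show "up id n = id n" for n by (cases n) auto
qed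

lemma ren_comp: "ren f (ren g A) = ren (f \<circ> g) A"
  by (induction A arbitrary: f g) (auto simp: up_comp)

lemma ren_id: "ren id A = A"
  by (induction A) (simp_all add: up_id[unfolded id_def] id_def)

lemma lift_connectives [simp]:
  "lift \<^bold>\<bottom> = \<^bold>\<bottom>"
  "lift (A \<^bold>\<rightarrow> B) = (lift A \<^bold>\<rightarrow> lift B)"
  "lift (A \<^bold>\<or> B) = (lift A \<^bold>\<or> lift B)"
  by (simp_all add: lift_def)

lemma inst_connectives [simp]:
  "inst \<^bold>\<bottom> t = \<^bold>\<bottom>"
  "inst (A \<^bold>\<rightarrow> B) t = (inst A t \<^bold>\<rightarrow> inst B t)"
  by (simp_all add: inst_def)

lemma inst_lift [simp]: "inst (lift A) t = A"
proof -
  have "case_nat t id \<circ> Suc = (id :: nat \<Rightarrow> nat)" by auto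
  then show ?thesis by (simp add: inst_def lift_def ren_comp ren_id)
qed

lemma inst_ren_up_Suc: "inst (ren (up Suc) P) 0 = P"
proof -
  have "case_nat 0 id \<circ> up Suc = id"
  proof
    show "(case_nat 0 id \<circ> up Suc) n = id n" for n by (cases n) auto
  qed
  then show ?thesis by (simp add: inst_def ren_comp ren_id)
qed

text \<open>
  After an eigenvariable rule, assumptions are lifted and the new variable has index 0.  Instantiating
  a lifted \<open>\<forall>P\<close> with this variable gives back \<open>P\<close> itself, and dually for \<open>\<exists>P\<close>.
\<close>

lemma AllE_fresh: "Ax \<parallel> \<Gamma> \<turnstile> lift (\<^bold>\<forall>P) \<Longrightarrow> Ax \<parallel> \<Gamma> \<turnstile> P"
  using AllE[of Ax \<Gamma> "ren (up Suc) P" 0] by (simp add: lift_def inst_ren_up_Suc)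

lemma ExI_fresh: "Ax \<parallel> \<Gamma> \<turnstile> P \<Longrightarrow> Ax \<parallel> \<Gamma> \<turnstile> lift (\<^bold>\<exists>P)"
  using ExI[of Ax \<Gamma> "ren (up Suc) P" 0] by (simp add: lift_def inst_ren_up_Suc)

lemma deriv_weaken: "Ax \<parallel> \<Gamma> \<turnstile> A \<Longrightarrow> \<Gamma> \<subseteq> \<Delta> \<Longrightarrow> Ax \<parallel> \<Delta> \<turnstile> A"
proof (induction arbitrary: \<Delta> rule: deriv.induct)
  case (Axiom A \<Gamma>)
  then show ?case by (simp add: deriv.Axiom)
next
  case (Assm A \<Gamma>)
  then show ?case by (auto intro: deriv.Assm)
next
  case (ImpI A \<Gamma> B)
  then show ?case by (meson deriv.ImpI insert_mono)
next
  case (ImpE \<Gamma> A B)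
  then show ?case by (meson deriv.ImpE)
next
  case (AndI \<Gamma> A B)
  then show ?case by (simp add: deriv.AndI)
next
  case (AndE1 \<Gamma> A B)
  then show ?case by (meson deriv.AndE1)
next
  case (AndE2 \<Gamma> A B)
  then show ?case by (meson deriv.AndE2)
next
  case (OrI1 \<Gamma> A B)
  then show ?case by (simp add: deriv.OrI1)
next
  case (OrI2 \<Gamma> B A)
  then show ?case by (simp add: deriv.OrI2)
next
  case (OrE \<Gamma> A B C)
  then show ?case by (meson deriv.OrE insert_mono)
next
  case (AllI \<Gamma> A)
  then show ?case by (meson deriv.AllI image_mono)
next
  case (AllE \<Gamma> A t)
  then show ?case by (simp add: deriv.AllE)
next
  case (ExI \<Gamma> A t)
  then show ?case by (meson deriv.ExI)
next
  case (ExE \<Gamma> A C)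
  then show ?case by (meson deriv.ExE image_mono insert_mono)
qed

text \<open>
  Axioms are rules without premises, so a derivation of an axiom must be valid under arbitrary
  assumptions, in particular under lifted ones; this is why it may not use any assumption itself.
\<close>

lemma deriv_cut_axioms:
  assumes "Bx \<parallel> \<Gamma> \<turnstile> A" and "\<And>B. B \<in> Bx \<Longrightarrow> Ax \<parallel> {} \<turnstile> B"
  shows "Ax \<parallel> \<Gamma> \<turnstile> A"
  using assms(1)
proof (induction rule: deriv.induct)
  case (Axiom A \<Gamma>)
  then show ?case using assms(2) deriv_weaken by blast
qed (rule deriv.intros; assumption)+

lemma yields_trans: "yields {S} T \<Longrightarrow> yields {T} U \<Longrightarrow> yields {S} U"
  using deriv_cut_axioms by (simp add: yields_def) metis

lemma yields_singletonI:
  "(\<And>A. A \<in> instances T \<Longrightarrow> instances S \<parallel> {} \<turnstile> A) \<Longrightarrow> yields {S} T"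
  by (simp add: yields_def)

lemma Assm_insert [simp]: "Ax \<parallel> insert A \<Gamma> \<turnstile> A" by (simp add: Assm)

lemma Assm_insert2 [simp]: "Ax \<parallel> insert B (insert A \<Gamma>) \<turnstile> A" by (simp add: Assm)

lemma yields_LEM_GLPO: "yields {LEM} GLPO"
proof (rule yields_singletonI)
  fix A assume "A \<in> instances GLPO"
  then obtain P where A: "A = \<^bold>\<forall>(\<^bold>\<not>P) \<^bold>\<or> \<^bold>\<exists>P" by auto
  have 1: "instances LEM \<parallel> {\<^bold>\<not>(\<^bold>\<exists>P)} \<turnstile> \<^bold>\<forall>(\<^bold>\<not>P)"
    by (rule AllI, rule ImpI, rule ImpE[where A = "lift (\<^bold>\<exists>P)"], simp, rule ExI_fresh, simp)
  have "instances LEM \<parallel> {} \<turnstile> \<^bold>\<exists>P \<^bold>\<or> \<^bold>\<not>(\<^bold>\<exists>P)" by (auto intro: Axiom)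
  then show "instances LEM \<parallel> {} \<turnstile> A"
    unfolding A using OrI2[OF Assm_insert] OrI1[OF 1] by (rule OrE)
qed

lemma yields_GLPO_LEM: "yields {GLPO} LEM"
proof (rule yields_singletonI)
  fix X assume "X \<in> instances LEM"
  then obtain A where X: "X = A \<^bold>\<or> \<^bold>\<not>A" by auto
  have 1: "instances GLPO \<parallel> {\<^bold>\<forall>(\<^bold>\<not>(lift A))} \<turnstile> \<^bold>\<not>A"
    using AllE[of "instances GLPO" "{\<^bold>\<forall>(\<^bold>\<not>(lift A))}" "\<^bold>\<not>(lift A)" 0] by (simp add: Assm)
  have 2: "instances GLPO \<parallel> {\<^bold>\<exists>(lift A)} \<turnstile> A"
    by (rule ExE[where A = "lift A"]) auto
  have "instances GLPO \<parallel> {} \<turnstile> \<^bold>\<forall>(\<^bold>\<not>(lift A)) \<^bold>\<or> \<^bold>\<exists>(lift A)" by (auto intro: Axiom)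
  then show "instances GLPO \<parallel> {} \<turnstile> X"
    unfolding X using OrI2[OF 1] OrI1[OF 2] by (rule OrE)
qed

lemma yields_DNSU_WGMP: "yields {DNSU} WGMP"
proof (rule yields_singletonI)
  fix A assume "A \<in> instances WGMP"
  then obtain P where A: "A = \<^bold>\<not>(\<^bold>\<forall>P) \<^bold>\<rightarrow> \<^bold>\<not>(\<^bold>\<not>(\<^bold>\<exists>(\<^bold>\<not>P)))" by auto
  let ?G = "{\<^bold>\<not>(\<^bold>\<exists>(\<^bold>\<not>P)), \<^bold>\<not>(\<^bold>\<forall>P)}"
  have "instances DNSU \<parallel> ?G \<turnstile> \<^bold>\<forall>(\<^bold>\<not>(\<^bold>\<not>P))"
    by (rule AllI, rule ImpI, rule ImpE[where A = "lift (\<^bold>\<exists>(\<^bold>\<not>P))"], simp, rule ExI_fresh, simp)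
  moreover have "instances DNSU \<parallel> ?G \<turnstile> \<^bold>\<forall>(\<^bold>\<not>(\<^bold>\<not>P)) \<^bold>\<rightarrow> \<^bold>\<not>(\<^bold>\<not>(\<^bold>\<forall>P))"
    by (auto intro: Axiom)
  ultimately have "instances DNSU \<parallel> ?G \<turnstile> \<^bold>\<not>(\<^bold>\<not>(\<^bold>\<forall>P))" by (rule ImpE[rotated])
  then have "instances DNSU \<parallel> ?G \<turnstile> \<^bold>\<bottom>" by (rule ImpE) simp
  then show "instances DNSU \<parallel> {} \<turnstile> A"
    unfolding A by (intro ImpI)
qed

lemma yields_WGMP_DNSU: "yields {WGMP} DNSU"
proof (rule yields_singletonI)
  fix A assume "A \<in> instances DNSU"
  then obtain P where A: "A = \<^bold>\<forall>(\<^bold>\<not>(\<^bold>\<not>P)) \<^bold>\<rightarrow> \<^bold>\<not>(\<^bold>\<not>(\<^bold>\<forall>P))" by auto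
  let ?G = "{\<^bold>\<not>(\<^bold>\<forall>P), \<^bold>\<forall>(\<^bold>\<not>(\<^bold>\<not>P))}"
  have "instances WGMP \<parallel> ?G \<turnstile> \<^bold>\<not>(\<^bold>\<exists>(\<^bold>\<not>P))"
    by (rule ImpI, rule ExE[where A = "\<^bold>\<not>P"], simp, simp,
        rule ImpE[where A = "\<^bold>\<not>P"], rule AllE_fresh) (auto intro: Assm)
  moreover have "instances WGMP \<parallel> ?G \<turnstile> \<^bold>\<not>(\<^bold>\<forall>P) \<^bold>\<rightarrow> \<^bold>\<not>(\<^bold>\<not>(\<^bold>\<exists>(\<^bold>\<not>P)))"
    by (auto intro: Axiom)
  then have "instances WGMP \<parallel> ?G \<turnstile> \<^bold>\<not>(\<^bold>\<not>(\<^bold>\<exists>(\<^bold>\<not>P)))" by (rule ImpE) simp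
  ultimately have "instances WGMP \<parallel> ?G \<turnstile> \<^bold>\<bottom>" by (rule ImpE[rotated])
  then show "instances WGMP \<parallel> {} \<turnstile> A"
    unfolding A by (intro ImpI)
qed

lemma yields_DP_GMP: "yields {DP} GMP"
proof (rule yields_singletonI)
  fix A assume "A \<in> instances GMP"
  then obtain P where A: "A = \<^bold>\<not>(\<^bold>\<forall>P) \<^bold>\<rightarrow> \<^bold>\<exists>(\<^bold>\<not>P)" by auto
  have "instances DP \<parallel> {\<^bold>\<not>(\<^bold>\<forall>P)} \<turnstile> \<^bold>\<exists>(P \<^bold>\<rightarrow> lift (\<^bold>\<forall>P))"
    by (auto intro: Axiom)
  then have "instances DP \<parallel> {\<^bold>\<not>(\<^bold>\<forall>P)} \<turnstile> \<^bold>\<exists>(\<^bold>\<not>P)"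
    by (rule ExE) (rule ExI_fresh, rule ImpI, rule ImpE[where A = "lift (\<^bold>\<forall>P)"], simp add: Assm,
        rule ImpE[where A = P], simp_all)
  then show "instances DP \<parallel> {} \<turnstile> A"
    unfolding A by (intro ImpI)
qed

lemma yields_DP_CD: "yields {DP} CD"
proof (rule yields_singletonI)
  fix A assume "A \<in> instances CD"
  then obtain P Q where A: "A = \<^bold>\<forall>(P \<^bold>\<or> lift (\<^bold>\<exists>Q)) \<^bold>\<rightarrow> (\<^bold>\<forall>P \<^bold>\<or> \<^bold>\<exists>Q)" by auto
  let ?G = "{\<^bold>\<forall>(P \<^bold>\<or> lift (\<^bold>\<exists>Q))}"
  let ?H = "insert (P \<^bold>\<rightarrow> lift (\<^bold>\<forall>P)) (lift ` ?G)"
  have "instances DP \<parallel> ?H \<turnstile> P \<^bold>\<or> lift (\<^bold>\<exists>Q)"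
    by (rule AllE_fresh) simp
  then have "instances DP \<parallel> ?H \<turnstile> lift (\<^bold>\<forall>P) \<^bold>\<or> lift (\<^bold>\<exists>Q)"
    by (rule OrE) (rule OrI1, rule ImpE[where A = P], simp_all add: OrI2)
  then have "instances DP \<parallel> ?H \<turnstile> lift (\<^bold>\<forall>P \<^bold>\<or> \<^bold>\<exists>Q)" by simp
  moreover have "instances DP \<parallel> ?G \<turnstile> \<^bold>\<exists>(P \<^bold>\<rightarrow> lift (\<^bold>\<forall>P))"
    by (auto intro: Axiom)
  ultimately have "instances DP \<parallel> ?G \<turnstile> \<^bold>\<forall>P \<^bold>\<or> \<^bold>\<exists>Q" by (rule ExE[rotated])
  then show "instances DP \<parallel> {} \<turnstile> A"
    unfolding A by (intro ImpI)
qed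

lemma yields_GLPOA_GMP: "yields {GLPOA} GMP"
proof (rule yields_singletonI)
  fix A assume "A \<in> instances GMP"
  then obtain P where A: "A = \<^bold>\<not>(\<^bold>\<forall>P) \<^bold>\<rightarrow> \<^bold>\<exists>(\<^bold>\<not>P)" by auto
  have "instances GLPOA \<parallel> {\<^bold>\<forall>P, \<^bold>\<not>(\<^bold>\<forall>P)} \<turnstile> \<^bold>\<bottom>"
    by (rule ImpE[where A = "\<^bold>\<forall>P"]) auto
  then have "instances GLPOA \<parallel> {\<^bold>\<forall>P, \<^bold>\<not>(\<^bold>\<forall>P)} \<turnstile> inst (\<^bold>\<not>P) 0"
    by simp (rule ImpI, erule deriv_weaken, blast)
  then have 1: "instances GLPOA \<parallel> {\<^bold>\<forall>P, \<^bold>\<not>(\<^bold>\<forall>P)} \<turnstile> \<^bold>\<exists>(\<^bold>\<not>P)"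
    by (rule ExI)
  have "instances GLPOA \<parallel> {\<^bold>\<not>(\<^bold>\<forall>P)} \<turnstile> \<^bold>\<forall>P \<^bold>\<or> \<^bold>\<exists>(\<^bold>\<not>P)" by (auto intro: Axiom)
  then have "instances GLPOA \<parallel> {\<^bold>\<not>(\<^bold>\<forall>P)} \<turnstile> \<^bold>\<exists>(\<^bold>\<not>P)"
    using 1 Assm_insert by (rule OrE)
  then show "instances GLPOA \<parallel> {} \<turnstile> A"
    unfolding A by (intro ImpI)
qed

lemma yields_GLPOA_LEM: "yields {GLPOA} LEM"
proof (rule yields_singletonI)
  fix X assume "X \<in> instances LEM"
  then obtain A where X: "X = A \<^bold>\<or> \<^bold>\<not>A" by auto
  have 1: "instances GLPOA \<parallel> {\<^bold>\<forall>(lift A)} \<turnstile> A"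
    using AllE[of "instances GLPOA" "{\<^bold>\<forall>(lift A)}" "lift A" 0] by (simp add: Assm)
  have 2: "instances GLPOA \<parallel> {\<^bold>\<exists>(\<^bold>\<not>(lift A))} \<turnstile> \<^bold>\<not>A"
    by (rule ExE[where A = "\<^bold>\<not>(lift A)"]) auto
  have "instances GLPOA \<parallel> {} \<turnstile> \<^bold>\<forall>(lift A) \<^bold>\<or> \<^bold>\<exists>(\<^bold>\<not>(lift A))" by (auto intro: Axiom)
  then show "instances GLPOA \<parallel> {} \<turnstile> X"
    unfolding X using OrI1[OF 1] OrI2[OF 2] by (rule OrE)
qed

lemma yields_GMP_DNSE: "yields {GMP} DNSE"
proof (rule yields_singletonI)
  fix A assume "A \<in> instances DNSE"
  then obtain P where A: "A = \<^bold>\<not>(\<^bold>\<not>(\<^bold>\<exists>P)) \<^bold>\<rightarrow> \<^bold>\<exists>(\<^bold>\<not>(\<^bold>\<not>P))" by auto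
  let ?G = "{\<^bold>\<not>(\<^bold>\<not>(\<^bold>\<exists>P))}"
  have "instances GMP \<parallel> {\<^bold>\<forall>(\<^bold>\<not>P), \<^bold>\<not>(\<^bold>\<not>(\<^bold>\<exists>P))} \<turnstile> \<^bold>\<not>(\<^bold>\<exists>P)"
    by (rule ImpI, rule ExE[where A = P], simp, simp,
        rule ImpE[where A = P], rule AllE_fresh) (auto intro: Assm)
  then have "instances GMP \<parallel> ?G \<turnstile> \<^bold>\<not>(\<^bold>\<forall>(\<^bold>\<not>P))"
    by (intro ImpI) (rule ImpE[where A = "\<^bold>\<not>(\<^bold>\<exists>P)"], simp_all)
  moreover have "instances GMP \<parallel> ?G \<turnstile> \<^bold>\<not>(\<^bold>\<forall>(\<^bold>\<not>P)) \<^bold>\<rightarrow> \<^bold>\<exists>(\<^bold>\<not>(\<^bold>\<not>P))"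
    by (auto intro: Axiom)
  ultimately have "instances GMP \<parallel> ?G \<turnstile> \<^bold>\<exists>(\<^bold>\<not>(\<^bold>\<not>P))" by (rule ImpE[rotated])
  then show "instances GMP \<parallel> {} \<turnstile> A"
    unfolding A by (intro ImpI)
qed

lemma yields_GMP_DNSU: "yields {GMP} DNSU"
proof (rule yields_singletonI)
  fix A assume "A \<in> instances DNSU"
  then obtain P where A: "A = \<^bold>\<forall>(\<^bold>\<not>(\<^bold>\<not>P)) \<^bold>\<rightarrow> \<^bold>\<not>(\<^bold>\<not>(\<^bold>\<forall>P))" by auto
  let ?G = "{\<^bold>\<not>(\<^bold>\<forall>P), \<^bold>\<forall>(\<^bold>\<not>(\<^bold>\<not>P))}"
  have "instances GMP \<parallel> ?G \<turnstile> \<^bold>\<not>(\<^bold>\<forall>P) \<^bold>\<rightarrow> \<^bold>\<exists>(\<^bold>\<not>P)"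
    by (auto intro: Axiom)
  then have "instances GMP \<parallel> ?G \<turnstile> \<^bold>\<exists>(\<^bold>\<not>P)" by (rule ImpE) simp
  then have "instances GMP \<parallel> ?G \<turnstile> \<^bold>\<bottom>"
    by (rule ExE) (simp, rule ImpE[where A = "\<^bold>\<not>P"], rule AllE_fresh, auto intro: Assm)
  then show "instances GMP \<parallel> {} \<turnstile> A"
    unfolding A by (intro ImpI)
qed

lemma yields_HE_DNSE: "yields {HE} DNSE"
proof (rule yields_singletonI)
  fix A assume "A \<in> instances DNSE"
  then obtain P where A: "A = \<^bold>\<not>(\<^bold>\<not>(\<^bold>\<exists>P)) \<^bold>\<rightarrow> \<^bold>\<exists>(\<^bold>\<not>(\<^bold>\<not>P))" by auto
  let ?G = "{\<^bold>\<not>(\<^bold>\<not>(\<^bold>\<exists>P))}"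
  let ?H = "insert (lift (\<^bold>\<exists>P) \<^bold>\<rightarrow> P) (lift ` ?G)"
  have "instances HE \<parallel> insert (\<^bold>\<not>P) ?H \<turnstile> \<^bold>\<not>(lift (\<^bold>\<exists>P))"
    by (rule ImpI, rule ImpE[where A = P], simp, rule ImpE[where A = "lift (\<^bold>\<exists>P)"])
      (auto intro: Assm)
  then have "instances HE \<parallel> insert (\<^bold>\<not>P) ?H \<turnstile> \<^bold>\<bottom>"
    by (rule ImpE[rotated]) (auto intro: Assm)
  then have "instances HE \<parallel> ?H \<turnstile> lift (\<^bold>\<exists>(\<^bold>\<not>(\<^bold>\<not>P)))"
    by (intro ExI_fresh ImpI)
  moreover have "instances HE \<parallel> ?G \<turnstile> \<^bold>\<exists>(lift (\<^bold>\<exists>P) \<^bold>\<rightarrow> P)" by (auto intro: Axiom)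
  ultimately have "instances HE \<parallel> ?G \<turnstile> \<^bold>\<exists>(\<^bold>\<not>(\<^bold>\<not>P))" by (rule ExE[rotated])
  then show "instances HE \<parallel> {} \<turnstile> A"
    unfolding A by (intro ImpI)
qed

lemma yields_LEM_DNSE: "yields {LEM} DNSE"
proof (rule yields_singletonI)
  fix A assume "A \<in> instances DNSE"
  then obtain P where A: "A = \<^bold>\<not>(\<^bold>\<not>(\<^bold>\<exists>P)) \<^bold>\<rightarrow> \<^bold>\<exists>(\<^bold>\<not>(\<^bold>\<not>P))" by auto
  let ?G = "{\<^bold>\<not>(\<^bold>\<not>(\<^bold>\<exists>P))}"
  have 1: "instances LEM \<parallel> insert (\<^bold>\<exists>P) ?G \<turnstile> \<^bold>\<exists>(\<^bold>\<not>(\<^bold>\<not>P))"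
    by (rule ExE[where A = P], simp, intro ExI_fresh ImpI, rule ImpE[where A = P])
      (auto intro: Assm)
  have "instances LEM \<parallel> insert (\<^bold>\<not>(\<^bold>\<exists>P)) ?G \<turnstile> \<^bold>\<bottom>"
    by (rule ImpE[where A = "\<^bold>\<not>(\<^bold>\<exists>P)"]) simp_all
  then have "instances LEM \<parallel> insert (\<^bold>\<not>(\<^bold>\<exists>P)) ?G \<turnstile> inst (\<^bold>\<not>(\<^bold>\<not>P)) 0"
    by simp (rule ImpI, erule deriv_weaken, blast)
  then have 2: "instances LEM \<parallel> insert (\<^bold>\<not>(\<^bold>\<exists>P)) ?G \<turnstile> \<^bold>\<exists>(\<^bold>\<not>(\<^bold>\<not>P))"
    by (rule ExI)
  have "instances LEM \<parallel> ?G \<turnstile> \<^bold>\<exists>P \<^bold>\<or> \<^bold>\<not>(\<^bold>\<exists>P)" by (auto intro: Axiom)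
  then have "instances LEM \<parallel> ?G \<turnstile> \<^bold>\<exists>(\<^bold>\<not>(\<^bold>\<not>P))"
    using 1 2 by (rule OrE)
  then show "instances LEM \<parallel> {} \<turnstile> A"
    unfolding A by (intro ImpI)
qed

lemma yields_LEM_WLEM: "yields {LEM} WLEM"
  by (rule yields_singletonI) (auto intro: Axiom)

lemma yields_DGP_WLEM: "yields {DGP} WLEM"
proof (rule yields_singletonI)
  fix X assume "X \<in> instances WLEM"
  then obtain A where X: "X = \<^bold>\<not>A \<^bold>\<or> \<^bold>\<not>(\<^bold>\<not>A)" by auto
  have 1: "instances DGP \<parallel> {A \<^bold>\<rightarrow> \<^bold>\<not>A} \<turnstile> \<^bold>\<not>A"
    by (rule ImpI, rule ImpE[where A = A], rule ImpE[where A = A]) simp_all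
  have 2: "instances DGP \<parallel> {\<^bold>\<not>A \<^bold>\<rightarrow> A} \<turnstile> \<^bold>\<not>(\<^bold>\<not>A)"
    by (rule ImpI, rule ImpE[where A = A], simp, rule ImpE[where A = "\<^bold>\<not>A"]) simp_all
  have "instances DGP \<parallel> {} \<turnstile> (A \<^bold>\<rightarrow> \<^bold>\<not>A) \<^bold>\<or> (\<^bold>\<not>A \<^bold>\<rightarrow> A)" by (auto intro: Axiom)
  then show "instances DGP \<parallel> {} \<turnstile> X"
    unfolding X using OrI1[OF 1] OrI2[OF 2] by (rule OrE)
qed


section \<open>Topological models\<close>

text \<open>
  The semantics takes values in the complete Heyting algebra of open sets.  The extent \<open>E d\<close> bounds
  quantification over \<open>d\<close>; falsum is an open set without further conditions, as minimal logic
  has no rule for it.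
\<close>

locale topological_model =
  fixes X :: "'w topology" and E :: "'d \<Rightarrow> 'w set"
    and V :: "nat \<Rightarrow> 'd list \<Rightarrow> 'w set" and F :: "'w set"
  assumes openin_E: "openin X (E d)" and openin_V: "openin X (V r ds)" and openin_F: "openin X F"
begin

definition imp :: "'w set \<Rightarrow> 'w set \<Rightarrow> 'w set" where
  "imp S T = X interior_of (- S \<union> T)"

primrec val :: "(nat \<Rightarrow> 'd) \<Rightarrow> form \<Rightarrow> 'w set" where
  "val e (Rel r xs) = V r (map e xs)"
| "val e \<^bold>\<bottom> = F"
| "val e (A \<^bold>\<rightarrow> B) = imp (val e A) (val e B)"
| "val e (A \<^bold>\<or> B) = val e A \<union> val e B"
| "val e (A \<^bold>\<and> B) = val e A \<inter> val e B"
| "val e (\<^bold>\<forall>A) = X interior_of (\<Inter>d. - E d \<union> val (case_nat d e) A)"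
| "val e (\<^bold>\<exists>A) = (\<Union>d. E d \<inter> val (case_nat d e) A)"

lemma openin_val: "openin X (val e A)"
  by (induction A arbitrary: e) (auto simp: openin_E openin_V openin_F imp_def openin_Int)

lemma val_ren: "val e (ren f A) = val (e \<circ> f) A"
proof (induction A arbitrary: e f)
  have *: "case_nat d e \<circ> up f = case_nat d (e \<circ> f)" for d and e :: "nat \<Rightarrow> 'd" and f
  proof
    show "(case_nat d e \<circ> up f) n = case_nat d (e \<circ> f) n" for n by (cases n) auto
  qed
  {
    case (All A)
    then show ?case by (simp add: *[unfolded comp_def] comp_def)
  next
    case (Ex A)
    then show ?case by (simp add: *[unfolded comp_def] comp_def)
  }
qed simp_all

lemma val_lift [simp]: "val (case_nat d e) (lift A) = val e A"
proof -
  have "case_nat d e \<circ> Suc = e" by auto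
  then show ?thesis by (simp add: lift_def val_ren)
qed

lemma val_inst: "val e (inst A t) = val (case_nat (e t) e) A"
proof -
  have "e \<circ> case_nat t id = case_nat (e t) e" by (auto split: nat.split)
  then show ?thesis by (simp add: inst_def val_ren)
qed

text \<open>
  A free variable stands for an individual that exists, so a formula only has to hold where all
  values of the environment exist.  There are infinitely many variables, and the intersection of
  their extents need not be open; the quantification over open sets \<open>U\<close> inside it avoids this.
\<close>

definition valid :: "form \<Rightarrow> bool" where
  "valid A \<longleftrightarrow> (\<forall>e U. openin X U \<longrightarrow> (\<forall>i. U \<subseteq> E (e i)) \<longrightarrow> U \<subseteq> val e A)"

lemma subset_imp_iff: "openin X U \<Longrightarrow> U \<subseteq> imp S T \<longleftrightarrow> U \<inter> S \<subseteq> T"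
  unfolding imp_def by (auto simp: interior_of_maximal_eq)

text \<open>
  The induction works because \<open>U\<close> varies: discharging an assumption or introducing an eigenvariable
  replaces \<open>U\<close> by its intersection with the value of the assumption or with the extent of the new
  individual.
\<close>

theorem soundness:
  assumes "Ax \<parallel> \<Gamma> \<turnstile> A" and "\<And>B. B \<in> Ax \<Longrightarrow> valid B"
    and "openin X U" and "\<And>i. U \<subseteq> E (e i)" and "\<And>B. B \<in> \<Gamma> \<Longrightarrow> U \<subseteq> val e B"
  shows "U \<subseteq> val e A"
  using assms(1,3-)
proof (induction arbitrary: e U rule: deriv.induct)
  case (Axiom A \<Gamma>)
  then show ?case using assms(2) by (auto simp: valid_def)
next
  case (ImpI A \<Gamma> B)
  have "U \<inter> val e A \<subseteq> val e B"
    by (rule ImpI.IH) (use ImpI.prems in \<open>auto simp: openin_val openin_Int\<close>)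
  then show ?case using ImpI.prems by (simp add: subset_imp_iff)
next
  case (ImpE \<Gamma> A B)
  have "U \<subseteq> val e (A \<^bold>\<rightarrow> B)" "U \<subseteq> val e A"
    by (rule ImpE.IH; use ImpE.prems in blast)+
  then show ?case using ImpE.prems(1) by (auto simp: subset_imp_iff)
next
  case (OrE \<Gamma> A B C)
  have "U \<inter> val e A \<subseteq> val e C" "U \<inter> val e B \<subseteq> val e C"
    by (rule OrE.IH; use OrE.prems in \<open>auto simp: openin_val openin_Int\<close>)+
  moreover have "U \<subseteq> val e (A \<^bold>\<or> B)"
    by (rule OrE.IH; use OrE.prems in blast)
  ultimately show ?case by auto
next
  case (AllI \<Gamma> A)
  have "U \<inter> E d \<subseteq> val (case_nat d e) A" for d
    by (rule AllI.IH)
      (use AllI.prems in \<open>auto simp: openin_E openin_Int subset_iff split: nat.split\<close>)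
  then show ?case using AllI.prems by (auto simp: interior_of_maximal_eq)
next
  case (AllE \<Gamma> A t)
  have "U \<subseteq> val e (\<^bold>\<forall>A)"
    by (rule AllE.IH) (use AllE.prems in blast)+
  moreover have "U \<subseteq> E (e t)" using AllE.prems by blast
  ultimately show ?case using AllE.prems(1) by (auto simp: val_inst interior_of_maximal_eq)
next
  case (ExI \<Gamma> A t)
  have "U \<subseteq> val e (inst A t)"
    by (rule ExI.IH) (use ExI.prems in blast)+
  moreover have "U \<subseteq> E (e t)" using ExI.prems by blast
  ultimately show ?case by (auto simp: val_inst)
next
  case (ExE \<Gamma> A C)
  have "U \<inter> E d \<inter> val (case_nat d e) A \<subseteq> val (case_nat d e) (lift C)" for d
    by (rule ExE.IH)
      (use ExE.prems in \<open>auto simp: openin_E openin_val openin_Int subset_iff split: nat.split\<close>)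
  moreover have "U \<subseteq> val e (\<^bold>\<exists>A)"
    by (rule ExE.IH) (use ExE.prems in blast)+
  ultimately show ?case by fastforce
qed (simp_all add: le_supI1 le_supI2)

lemma not_yields:
  assumes "\<And>A. A \<in> instances S \<Longrightarrow> valid A" and "B \<in> instances T" and "\<not> valid B"
  shows "\<not> yields {S} T"
proof
  assume "yields {S} T"
  then have "instances S \<parallel> {} \<turnstile> B" using assms(2) by (simp add: yields_def)
  then have "valid B"
    unfolding valid_def using soundness[OF _ assms(1)] by (metis empty_iff)
  then show False using assms(3) by simp
qed

lemma valid_DGP:
  assumes "\<And>S T x. openin X S \<Longrightarrow> openin X T \<Longrightarrow> x \<in> topspace X \<Longrightarrow> x \<in> imp S T \<or> x \<in> imp T S"
    and "A \<in> instances DGP"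
  shows "valid A"
proof -
  from assms(2) obtain B C where A: "A = (B \<^bold>\<rightarrow> C) \<^bold>\<or> (C \<^bold>\<rightarrow> B)" by auto
  show ?thesis
    unfolding valid_def A using assms(1)[OF openin_val openin_val] openin_subset by fastforce
qed

end

text \<open>
  With a constant domain the extents disappear and validity means being true at every point.  The
  lemmas below turn each schema into a condition on families of open sets.
\<close>

locale constant_domain = topological_model X "\<lambda>_. UNIV" V F
  for X :: "'w topology" and V :: "nat \<Rightarrow> 'd list \<Rightarrow> 'w set" and F :: "'w set" +
  assumes topspace_UNIV: "topspace X = UNIV"
begin

lemma valid_iff: "valid A \<longleftrightarrow> (\<forall>e x. x \<in> val e A)"
  using openin_topspace[of X] by (auto simp: valid_def topspace_UNIV)

lemma not_validI: "x \<notin> val e A \<Longrightarrow> \<not> valid A"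
  by (auto simp: valid_iff)

lemma valid_HE:
  assumes "\<And>(p :: 'd \<Rightarrow> 'w set) x. (\<And>d. openin X (p d)) \<Longrightarrow> \<exists>d. x \<in> imp (\<Union>c. p c) (p d)"
    and "A \<in> instances HE"
  shows "valid A"
  using assms(2) by (auto simp: valid_iff intro!: assms(1) openin_val)

lemma valid_DP:
  assumes "\<And>(p :: 'd \<Rightarrow> 'w set) x.
      (\<And>d. openin X (p d)) \<Longrightarrow> \<exists>d. x \<in> imp (p d) (X interior_of (\<Inter>c. p c))"
    and "A \<in> instances DP"
  shows "valid A"
  using assms(2) by (auto simp: valid_iff intro!: assms(1) openin_val)

lemma valid_CD:
  assumes "\<And>(p :: 'd \<Rightarrow> 'w set) q. (\<And>d. openin X (p d)) \<Longrightarrow> openin X q \<Longrightarrow>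
      X interior_of (\<Inter>d. p d \<union> q) \<subseteq> X interior_of (\<Inter>d. p d) \<union> q"
    and "A \<in> instances CD"
  shows "valid A"
proof -
  from assms(2) obtain P Q where A: "A = \<^bold>\<forall>(P \<^bold>\<or> lift (\<^bold>\<exists>Q)) \<^bold>\<rightarrow> (\<^bold>\<forall>P \<^bold>\<or> \<^bold>\<exists>Q)" by auto
  have "UNIV \<subseteq> val e A" for e
    using openin_topspace[of X] openin_val[of e "\<^bold>\<exists>Q"]
      assms(1)[of "\<lambda>d. val (case_nat d e) P" "val e (\<^bold>\<exists>Q)"]
    unfolding A topspace_UNIV by (simp add: subset_imp_iff openin_val)
  then show ?thesis by (auto simp: valid_iff)
qed

lemma valid_LEM:
  assumes "\<And>S x. openin X S \<Longrightarrow> x \<in> S \<or> x \<in> imp S F" and "A \<in> instances LEM"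
  shows "valid A"
  using assms openin_val by (auto simp: valid_iff)

lemma valid_DNSU:
  assumes "\<And>(p :: 'd \<Rightarrow> 'w set). (\<And>d. openin X (p d)) \<Longrightarrow>
      X interior_of (\<Inter>d. imp (imp (p d) F) F) \<subseteq> imp (imp (X interior_of (\<Inter>d. p d)) F) F"
    and "A \<in> instances DNSU"
  shows "valid A"
proof -
  from assms(2) obtain P where A: "A = \<^bold>\<forall>(\<^bold>\<not>(\<^bold>\<not>P)) \<^bold>\<rightarrow> \<^bold>\<not>(\<^bold>\<not>(\<^bold>\<forall>P))" by auto
  have "UNIV \<subseteq> val e A" for e
    using openin_topspace[of X] assms(1)[of "\<lambda>d. val (case_nat d e) P"]
    unfolding A topspace_UNIV by (simp add: subset_imp_iff openin_val)
  then show ?thesis by (auto simp: valid_iff)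
qed

lemma valid_GLPOA:
  assumes "F = UNIV" and "A \<in> instances GLPOA"
  shows "valid A"
proof -
  from assms(2) obtain P where A: "A = \<^bold>\<forall>P \<^bold>\<or> \<^bold>\<exists>(\<^bold>\<not>P)" by auto
  have "imp S F = UNIV" for S
    using interior_of_topspace[of X] by (simp add: imp_def assms(1) topspace_UNIV)
  then show ?thesis by (simp add: valid_iff A)
qed

end

section \<open>Kripke models with constant domain\<close>

text \<open>
  In the topology of upward closed sets the interpretation is the usual forcing relation of a Kripke
  model.
\<close>

definition up_topology :: "('w \<Rightarrow> 'w \<Rightarrow> bool) \<Rightarrow> 'w topology" where
  "up_topology le = topology (\<lambda>U. \<forall>x\<in>U. \<forall>y. le x y \<longrightarrow> y \<in> U)"

lemma openin_up_topology: "openin (up_topology le) U \<longleftrightarrow> (\<forall>x\<in>U. \<forall>y. le x y \<longrightarrow> y \<in> U)"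
proof -
  have "istopology (\<lambda>U. \<forall>x\<in>U. \<forall>y. le x y \<longrightarrow> y \<in> U)"
    unfolding istopology_def by blast
  then show ?thesis by (simp add: up_topology_def)
qed

lemma topspace_up_topology: "topspace (up_topology le) = UNIV"
  unfolding topspace_def openin_up_topology by blast

lemma interior_of_up_topology:
  assumes "reflp le" and "transp le"
  shows "up_topology le interior_of S = {x. \<forall>y. le x y \<longrightarrow> y \<in> S}"
proof (rule interior_of_unique)
  show "{x. \<forall>y. le x y \<longrightarrow> y \<in> S} \<subseteq> S" using assms(1) by (auto dest: reflpD)
  show "openin (up_topology le) {x. \<forall>y. le x y \<longrightarrow> y \<in> S}"
    using assms(2) by (auto simp: openin_up_topology dest: transpD)
qed (auto simp: openin_up_topology)


text \<open>
  A world that does not force \<open>Q\<close> must force every \<open>P d\<close>, hence \<open>\<forall>P\<close>, because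
  no new individuals have to be considered later.
\<close>

lemma valid_CD_up_topology:
  fixes le :: "'w \<Rightarrow> 'w \<Rightarrow> bool" and V :: "nat \<Rightarrow> 'd list \<Rightarrow> 'w set"
  assumes "constant_domain (up_topology le) V F" and "reflp le" and "transp le"
    and "A \<in> instances CD"
  shows "topological_model.valid (up_topology le) (\<lambda>_. UNIV) V F A"
proof -
  interpret constant_domain "up_topology le" V F by fact
  show ?thesis
  proof (rule valid_CD[OF _ assms(4)], rule subsetI)
    fix p :: "'d \<Rightarrow> 'w set" and q x
    assume p: "\<And>d. openin (up_topology le) (p d)"
      and x: "x \<in> up_topology le interior_of (\<Inter>d. p d \<union> q)"
    then have "x \<in> p d \<union> q" for d using interior_of_subset by fastforce
    then show "x \<in> up_topology le interior_of (\<Inter>d. p d) \<union> q"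
      using p by (auto simp: interior_of_up_topology assms(2,3) openin_up_topology)
  qed
qed

definition fork_le :: "bool option \<Rightarrow> bool option \<Rightarrow> bool" where
  "fork_le x y \<longleftrightarrow> x = None \<or> x = y"

lemma fork_le_preorder: "reflp fork_le" "transp fork_le"
  by (auto simp: fork_le_def intro: reflpI transpI)

lemma interior_of_fork:
  "x \<in> up_topology fork_le interior_of S \<longleftrightarrow>
    x \<in> S \<and> (x = None \<longrightarrow> Some True \<in> S \<and> Some False \<in> S)"
  by ((cases x; auto simp: interior_of_up_topology fork_le_preorder fork_le_def
      split_option_all all_bool_eq), metis (full_types))

text \<open>
  At the leaf \<open>Some d\<close>, exactly \<open>d\<close> has the property, and falsum holds everywhere.
\<close>

lemma not_yields_GLPOA_HE_DGP: "\<not> yields {GLPOA} HE" "\<not> yields {GLPOA} DGP"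
proof -
  interpret constant_domain "up_topology fork_le" "\<lambda>r ds. Some ` set (ds :: bool list)" UNIV
    by unfold_locales (auto simp: openin_up_topology topspace_up_topology fork_le_def)
  have "\<not> valid (\<^bold>\<exists>(lift (\<^bold>\<exists>(Rel 0 [0])) \<^bold>\<rightarrow> Rel 0 [0]))"
    by (rule not_validI[where x = None]) (auto simp: imp_def interior_of_fork)
  then show "\<not> yields {GLPOA} HE"
    using valid_GLPOA by (intro not_yields[of GLPOA]) auto
  have "\<not> valid ((Rel 0 [0] \<^bold>\<rightarrow> Rel 0 [1]) \<^bold>\<or> (Rel 0 [1] \<^bold>\<rightarrow> Rel 0 [0]))"
    by (rule not_validI[where x = None and e = "\<lambda>n. n = 0"]) (auto simp: imp_def interior_of_fork)
  then show "\<not> yields {GLPOA} DGP"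
    using valid_GLPOA by (intro not_yields[of GLPOA]) auto
qed

text \<open>
  With one individual all quantifiers are trivial, and WLEM fails because the proposition holds at one
  leaf only.
\<close>

lemma not_yields_WLEM: "\<not> yields {DP} WLEM" "\<not> yields {HE} WLEM"
proof -
  interpret constant_domain "up_topology fork_le" "\<lambda>r ds. {Some (ds = ([] :: unit list))}" "{}"
    by unfold_locales (auto simp: openin_up_topology topspace_up_topology fork_le_def)
  have *: "\<not> valid (\<^bold>\<not>(Rel 0 []) \<^bold>\<or> \<^bold>\<not>(\<^bold>\<not>(Rel 0 [])))"
    by (rule not_validI[where x = None]) (auto simp: imp_def interior_of_fork)
  have "valid A" if "A \<in> instances DP" for A
    by (rule valid_DP[OF _ that]) 
      (simp add: imp_def UNIV_unit interior_of_openin interior_of_fork)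
  with * show "\<not> yields {DP} WLEM" by (intro not_yields[of DP]) auto
  have "valid A" if "A \<in> instances HE" for A
    by (rule valid_HE[OF _ that])
      (simp add: imp_def UNIV_unit interior_of_fork)
  with * show "\<not> yields {HE} WLEM" by (intro not_yields[of HE]) auto
qed

text \<open>
  The root forces that some individual has the property eventually, but no single one has it at
  both leaves.  DNSU holds since \<open>\<not>\<not>\<forall>P\<close> need only be checked at the leaves, where
  forcing is classical.
\<close>

lemma not_yields_DNSE: "\<not> yields {CD} DNSE" "\<not> yields {DNSU} DNSE"
proof -
  interpret constant_domain "up_topology fork_le" "\<lambda>r ds. Some ` set (ds :: bool list)" "{}"
    by unfold_locales (auto simp: openin_up_topology topspace_up_topology fork_le_def)
  have *: "\<not> valid (\<^bold>\<not>(\<^bold>\<not>(\<^bold>\<exists>(Rel 0 [0]))) \<^bold>\<rightarrow> \<^bold>\<exists>(\<^bold>\<not>(\<^bold>\<not>(Rel 0 [0]))))"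
    by (rule not_validI[where x = None]) (auto simp: imp_def interior_of_fork)
  have "valid A" if "A \<in> instances CD" for A
    by (rule valid_CD_up_topology[OF constant_domain_axioms fork_le_preorder that])
  with * show "\<not> yields {CD} DNSE" by (intro not_yields[of CD]) auto
  have "valid A" if "A \<in> instances DNSU" for A
  proof (rule valid_DNSU[OF _ that], rule subsetI)
    fix p :: "bool \<Rightarrow> bool option set" and x
    assume "x \<in> up_topology fork_le interior_of (\<Inter>d. imp (imp (p d) {}) {})"
    then show "x \<in> imp (imp (up_topology fork_le interior_of (\<Inter>d. p d)) {}) {}"
      by (cases x) (simp_all add: imp_def interior_of_fork)
  qed
  with * show "\<not> yields {DNSU} DNSE" by (intro not_yields[of DNSU]) auto
qed

text \<open>
  The individual \<open>d\<close> acquires its property at the world \<open>d\<close>.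
\<close>

lemma not_yields_CD_DNSU: "\<not> yields {CD} DNSU"
proof -
  have le: "reflp ((\<le>) :: nat \<Rightarrow> nat \<Rightarrow> bool)" "transp ((\<le>) :: nat \<Rightarrow> nat \<Rightarrow> bool)"
    by (auto intro: reflpI transpI)
  interpret constant_domain "up_topology (\<le>)" "\<lambda>r ds. {n :: nat. \<forall>d\<in>set ds. d \<le> n}" "{}"
    by unfold_locales (auto simp: openin_up_topology topspace_up_topology)
  have "valid A" if "A \<in> instances CD" for A
    by (rule valid_CD_up_topology[OF constant_domain_axioms le that])
  moreover
  have "\<not> valid (\<^bold>\<forall>(\<^bold>\<not>(\<^bold>\<not>(Rel 0 [0]))) \<^bold>\<rightarrow> \<^bold>\<not>(\<^bold>\<not>(\<^bold>\<forall>(Rel 0 [0]))))"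
  proof (rule not_validI[where x = 0 and e = "\<lambda>_. 0"])
    have 1: "imp {n. d \<le> n} {} = {}" for d :: nat
      by (auto simp: imp_def interior_of_up_topology le intro: max.cobounded1 max.cobounded2)
    have 2: "up_topology (\<le>) interior_of (\<Inter>d. {n :: nat. d \<le> n}) = {}"
      by (auto simp: interior_of_up_topology le) (meson Suc_n_not_le_n order_refl)
    show "0 \<notin> val (\<lambda>_. 0) (\<^bold>\<forall>(\<^bold>\<not>(\<^bold>\<not>(Rel 0 [0]))) \<^bold>\<rightarrow> \<^bold>\<not>(\<^bold>\<not>(\<^bold>\<forall>(Rel 0 [0]))))"
      using 1 2 by (simp add: imp_def) (simp add: interior_of_up_topology le)
  qed
  ultimately show ?thesis by (intro not_yields[of CD]) auto
qed

text \<open>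
  The worlds are \<open>None < \<dots> < Some 2 < Some 1 < Some 0\<close>.
\<close>

primrec costep_le :: "nat option \<Rightarrow> nat option \<Rightarrow> bool" where
  "costep_le None y \<longleftrightarrow> True"
| "costep_le (Some n) y \<longleftrightarrow> (\<exists>m\<le>n. y = Some m)"

lemma costep_le_preorder: "reflp costep_le" "transp costep_le"
  subgoal by (rule reflpI) (case_tac x; simp)
  subgoal by (rule transpI) (case_tac x; auto)
  done

text \<open>
  Inclusion well-orders the upward closed sets here: they are the initial segments
  \<open>{Some k | k < n}\<close>, then \<open>range Some\<close>, then everything.  Hence every family has a least member,
  whose index is a witness for DP.  But the strictly increasing family \<open>{Some k | k \<le> d}\<close> does not
  attain its union, so the root refutes HE.
\<close>

lemma not_yields_DP_HE: "\<not> yields {DP} HE"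
proof -
  interpret constant_domain "up_topology costep_le" "\<lambda>r ds. {Some m | m. \<forall>d\<in>set ds. m \<le> d}" "{}"
    by unfold_locales (fastforce simp: openin_up_topology topspace_up_topology)+
  have "valid A" if "A \<in> instances DP" for A
  proof (rule valid_DP[OF _ that])
    fix p :: "nat \<Rightarrow> nat option set" and x
    assume p: "\<And>d. openin (up_topology costep_le) (p d)"
    have down: "Some k \<in> p d" if "Some n \<in> p d" "k \<le> n" for d k n
      using p[of d] that by (force simp: openin_up_topology)
    have root: "p d = UNIV" if "None \<in> p d" for d
      using p[of d] that by (force simp: openin_up_topology)
    \<comment> \<open>The three cases are the possible least members: a finite segment, all worlds but the root,
      all worlds.\<close>
    show "\<exists>d. x \<in> imp (p d) (up_topology costep_le interior_of (\<Inter>c. p c))"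
    proof (cases "\<exists>n d. Some n \<notin> p d")
      case True
      define m where "m = (LEAST n. \<exists>d. Some n \<notin> p d)"
      from True have "\<exists>d. Some m \<notin> p d" unfolding m_def by (rule LeastI_ex)
      then obtain d where d: "Some m \<notin> p d" by blast
      have below: "Some k \<in> p c" if "k < m" for k c
        using not_less_Least[of k "\<lambda>n. \<exists>d. Some n \<notin> p d"] that unfolding m_def by blast
      have "p d \<subseteq> up_topology costep_le interior_of (\<Inter>c. p c)"
      proof (rule interior_of_maximal[OF _ p], rule subsetI)
        fix y assume y: "y \<in> p d"
        with root d obtain k where k: "y = Some k" by (cases y) auto
        then have "k < m" using down[of k d m] y d by (meson linorder_not_le)
        then show "y \<in> (\<Inter>c. p c)" using below k by blast
      qed
      then show ?thesis 
        by (intro exI[of _ d]) (simp add: imp_def interior_of_up_topology costep_le_preorder, blast)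
    next
      case False
      then show ?thesis
      proof (cases "\<exists>d. None \<notin> p d")
        case True
        then obtain d where "None \<notin> p d" by blast
        then have "p d = range Some" using False by (auto simp: image_iff) (metis not_None_eq)
        moreover have "range Some \<subseteq> (\<Inter>c. p c)" using False by auto
        ultimately have "p d \<subseteq> up_topology costep_le interior_of (\<Inter>c. p c)"
          by (metis interior_of_maximal p)
        then show ?thesis 
          by (intro exI[of _ d]) (simp add: imp_def interior_of_up_topology costep_le_preorder, blast)
      next
        case False
        then have "(\<Inter>c. p c) = UNIV" using root by blast
        then show ?thesis 
          by (simp add: imp_def interior_of_up_topology costep_le_preorder)
      qed
    qed
  qed
  moreover have "\<not> valid (\<^bold>\<exists>(lift (\<^bold>\<exists>(Rel 0 [0])) \<^bold>\<rightarrow> Rel 0 [0]))"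
    by (rule not_validI[where x = None])
      (auto simp: imp_def interior_of_up_topology costep_le_preorder,
        metis Suc_n_not_le_n option.inject order_refl)
  ultimately show ?thesis by (intro not_yields[of DP]) auto
qed

section \<open>A Kripke model with growing domain\<close>

text \<open>
  The individual \<open>True\<close> exists, and has its property, only at the upper world \<open>True\<close>; \<open>False\<close> never has
  it.  So the lower world forces \<open>\<not>\<not>\<exists>P\<close>, but its only individual is no witness.
\<close>

lemma not_yields_DGP_DNSE: "\<not> yields {DGP} DNSE"
proof -
  have le: "reflp ((\<le>) :: bool \<Rightarrow> bool \<Rightarrow> bool)" "transp ((\<le>) :: bool \<Rightarrow> bool \<Rightarrow> bool)"
    by (auto intro: reflpI transpI)
  interpret topological_model "up_topology (\<le>)" "atLeast :: bool \<Rightarrow> bool set"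
    "\<lambda>r ds. {w. w \<and> True \<in> set ds}" "{}"
    by unfold_locales (auto simp: openin_up_topology)
  have "valid A" if "A \<in> instances DGP" for A
    by (rule valid_DGP[OF _ that])
      (auto simp: imp_def interior_of_up_topology le openin_up_topology, (metis (full_types))?)
  moreover have "\<not> valid (\<^bold>\<not>(\<^bold>\<not>(\<^bold>\<exists>(Rel 0 [0]))) \<^bold>\<rightarrow> \<^bold>\<exists>(\<^bold>\<not>(\<^bold>\<not>(Rel 0 [0]))))"
  proof
    assume *: "valid (\<^bold>\<not>(\<^bold>\<not>(\<^bold>\<exists>(Rel 0 [0]))) \<^bold>\<rightarrow> \<^bold>\<exists>(\<^bold>\<not>(\<^bold>\<not>(Rel 0 [0]))))"
    have "UNIV \<subseteq> val (\<lambda>_. False) (\<^bold>\<not>(\<^bold>\<not>(\<^bold>\<exists>(Rel 0 [0]))) \<^bold>\<rightarrow> \<^bold>\<exists>(\<^bold>\<not>(\<^bold>\<not>(Rel 0 [0]))))"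
      by (rule *[unfolded valid_def, rule_format]) (auto simp: openin_up_topology)
    then show False
      by (auto simp: imp_def interior_of_up_topology le)
  qed
  ultimately show ?thesis by (intro not_yields[of DGP]) auto
qed

section \<open>A topological model that is not a Kripke model\<close>

text \<open>
  The points \<open>Some n\<close> form an ascending Kripke frame; \<open>None\<close> is a limit point of it that is not below
  any particular one of them, since its neighbourhoods contain only a final segment.
\<close>

definition spire :: "nat option topology" where
  "spire = topology (\<lambda>U. (\<forall>n m. Some n \<in> U \<longrightarrow> n \<le> m \<longrightarrow> Some m \<in> U) \<and> (None \<in> U \<longrightarrow> (\<exists>n. Some n \<in> U)))"

lemma openin_spire:
  "openin spire U \<longleftrightarrow>
    (\<forall>n m. Some n \<in> U \<longrightarrow> n \<le> m \<longrightarrow> Some m \<in> U) \<and> (None \<in> U \<longrightarrow> (\<exists>n. Some n \<in> U))"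
proof -
  define up where "up U \<longleftrightarrow> (\<forall>n m. Some n \<in> U \<longrightarrow> n \<le> m \<longrightarrow> Some m \<in> U)" for U :: "nat option set"
  have upD: "Some m \<in> U" if "up U" "Some n \<in> U" "n \<le> m" for U n m
    using that by (auto simp: up_def)
  define nbh where "nbh U \<longleftrightarrow> (None \<in> U \<longrightarrow> (\<exists>n. Some n \<in> U))" for U :: "nat option set"
  have "up (S \<inter> T)" if "up S" "up T" for S T
    using that unfolding up_def by (metis IntD1 IntD2 IntI)
  moreover have "nbh (S \<inter> T)" if "up S" "nbh S" "up T" "nbh T" for S T
    unfolding nbh_def
  proof
    assume "None \<in> S \<inter> T"
    with that obtain n m where "Some n \<in> S" "Some m \<in> T" by (auto simp: nbh_def)
    with that have "Some (max n m) \<in> S \<inter> T" by (auto intro: upD)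
    then show "\<exists>n. Some n \<in> S \<inter> T" ..
  qed
  moreover have "up (\<Union>K)" if "\<And>S. S \<in> K \<Longrightarrow> up S" for K
    using that by (auto simp: up_def)
  moreover have "nbh (\<Union>K)" if "\<And>S. S \<in> K \<Longrightarrow> nbh S" for K
    using that unfolding nbh_def by (metis UnionE UnionI)
  ultimately have "istopology (\<lambda>U. up U \<and> nbh U)" unfolding istopology_def by simp
  then show ?thesis by (simp add: spire_def up_def nbh_def)
qed

lemma topspace_spire: "topspace spire = UNIV"
proof -
  have "openin spire UNIV" by (simp add: openin_spire)
  then show ?thesis using openin_subset by blast
qed

lemma interior_of_spire:
  "Some n \<in> spire interior_of S \<longleftrightarrow> (\<forall>m\<ge>n. Some m \<in> S)" (is ?Some)
  "None \<in> spire interior_of S \<longleftrightarrow> None \<in> S \<and> (\<exists>n. \<forall>m\<ge>n. Some m \<in> S)" (is ?None)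
proof -
  have up: "Some m \<in> S" if "Some n \<in> spire interior_of S" "n \<le> m" for n m
  proof -
    have "Some m \<in> spire interior_of S"
      using openin_interior_of[of spire S] that unfolding openin_spire by metis
    then show ?thesis using interior_of_subset by fast
  qed
  show ?Some
  proof
    assume *: "\<forall>m\<ge>n. Some m \<in> S"
    have "Some ` {n..} \<subseteq> spire interior_of S"
      by (rule interior_of_maximal) (use * in \<open>auto simp: openin_spire\<close>)
    then show "Some n \<in> spire interior_of S" by auto
  qed (auto intro: up)
  show ?None
  proof
    assume *: "None \<in> spire interior_of S"
    then have "\<exists>n. Some n \<in> spire interior_of S"
      using openin_interior_of[of spire S] unfolding openin_spire by metis
    then have "\<exists>n. \<forall>m\<ge>n. Some m \<in> S" using up by metis
    moreover have "None \<in> S" using * interior_of_subset by fast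
    ultimately show "None \<in> S \<and> (\<exists>n. \<forall>m\<ge>n. Some m \<in> S)" by metis
  next
    assume "None \<in> S \<and> (\<exists>n. \<forall>m\<ge>n. Some m \<in> S)"
    then obtain n where *: "None \<in> S" "\<forall>m\<ge>n. Some m \<in> S" by metis
    have "insert None (Some ` {n..}) \<subseteq> spire interior_of S"
      by (rule interior_of_maximal) (use * in \<open>auto simp: openin_spire\<close>)
    then show "None \<in> spire interior_of S" by simp
  qed
qed

text \<open>
  Near \<open>Some n\<close> the open sets are final segments, of which the largest in a nonempty family is a
  member of the family.  Near \<open>None\<close> all final segments agree, so only three open sets can be
  distinguished there: the empty set, the final segments without \<open>None\<close>, and those with \<open>None\<close>.
\<close>

lemma spire_attained:
  assumes "\<And>i. openin spire (p i)"
  shows "\<exists>i. x \<in> spire interior_of (- (\<Union>j. p j) \<union> p i)"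
proof (cases x)
  case None
  show ?thesis
  proof (cases "\<exists>i. None \<in> p i")
    case True
    then show ?thesis using assms by (fastforce simp: None interior_of_spire openin_spire)
  next
    case False
    then show ?thesis using assms by (simp add: None interior_of_spire openin_spire) metis
  qed
next
  case (Some n)
  show ?thesis
  proof (cases "\<exists>m. n \<le> m \<and> (\<exists>i. Some m \<in> p i)")
    case True
    define m where "m = (LEAST m. n \<le> m \<and> (\<exists>i. Some m \<in> p i))"
    from True have "n \<le> m \<and> (\<exists>i. Some m \<in> p i)" unfolding m_def by (rule LeastI_ex)
    then obtain i where i: "Some m \<in> p i" by blast
    have "Some k \<in> p i" if "n \<le> k" "Some k \<in> p j" for k j
    proof -
      have "m \<le> k" unfolding m_def using that by (blast intro: Least_le)
      then show ?thesis using i assms[of i] by (auto simp: openin_spire)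
    qed
    then show ?thesis by (auto simp: Some interior_of_spire)
  next
    case False
    then show ?thesis by (auto simp: Some interior_of_spire)
  qed
qed

definition spire_val :: "nat \<Rightarrow> nat list \<Rightarrow> nat option set" where
  "spire_val r ds = (case ds of [] \<Rightarrow> range Some | d # _ \<Rightarrow> insert None (Some ` {d..}))"

text \<open>
  The separations from CD and from DNSU need different values of falsum, which therefore stays a
  parameter.
\<close>

lemma spire_model: "openin spire F \<Longrightarrow> constant_domain spire spire_val F"
  by unfold_locales (auto simp: topspace_spire openin_spire spire_val_def split: list.split)

lemma spire_valid:
  assumes "openin spire F"
  shows "A \<in> instances HE \<Longrightarrow> topological_model.valid spire (\<lambda>_. UNIV) spire_val F A"
    and "A \<in> instances DGP \<Longrightarrow> topological_model.valid spire (\<lambda>_. UNIV) spire_val F A"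
proof -
  interpret constant_domain spire spire_val F by (rule spire_model[OF assms])
  show "valid A" if "A \<in> instances HE"
    by (rule valid_HE[OF _ that]) (unfold imp_def, rule spire_attained)
  show "valid A" if "A \<in> instances DGP"
  proof (rule valid_DGP[OF _ that])
    fix S T x assume "openin spire S" "openin spire T"
    define p where "p c = (if c then S else T)" for c
    have union: "(\<Union>c. p c) = S \<union> T" by (simp add: p_def UNIV_bool Un_commute)
    have "openin spire (p c)" for c
      using \<open>openin spire S\<close> \<open>openin spire T\<close> by (simp add: p_def)
    then have "\<exists>b. x \<in> spire interior_of (- (\<Union>c. p c) \<union> p b)" by (rule spire_attained)
    then obtain b where b: "x \<in> spire interior_of (- (S \<union> T) \<union> p b)" unfolding union ..
    show "x \<in> imp S T \<or> x \<in> imp T S"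
    proof (cases b)
      case True
      then have "- (S \<union> T) \<union> p b \<subseteq> - T \<union> S" by (auto simp: p_def)
      then have "x \<in> imp T S" unfolding imp_def using b interior_of_mono by (metis subsetD)
      then show ?thesis ..
    next
      case False
      then have "- (S \<union> T) \<union> p b \<subseteq> - S \<union> T" by (auto simp: p_def)
      then have "x \<in> imp S T" unfolding imp_def using b interior_of_mono by (metis subsetD)
      then show ?thesis ..
    qed
  qed
qed

text \<open>
  The neighbourhoods \<open>insert None (Some ` {d..})\<close> of the limit point interpret \<open>P d\<close>.  Together with
  \<open>Q = range Some\<close> each of them covers the space, although their intersection has empty interior: this
  is the failure of CD at \<open>None\<close>.
\<close>

lemma spire_Inter: "spire interior_of (\<Inter>d. insert None (Some ` {d..})) = {}"
proof -
  have "Some m \<notin> (\<Inter>d. insert None (Some ` {d..}))" for m :: nat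
    by (auto intro: exI[of _ "Suc m"])
  then have "x \<notin> spire interior_of (\<Inter>d. insert None (Some ` {d..}))" for x
    by (cases x) (use interior_of_spire order_refl in metis)+
  then show ?thesis by auto
qed

lemma spire_not_CD:
  assumes "openin spire F"
  shows "\<not> topological_model.valid spire (\<lambda>_. UNIV) spire_val F
    (\<^bold>\<forall>(Rel 0 [0] \<^bold>\<or> lift (\<^bold>\<exists>(Rel 0 []))) \<^bold>\<rightarrow> (\<^bold>\<forall>(Rel 0 [0]) \<^bold>\<or> \<^bold>\<exists>(Rel 0 [])))"
proof -
  interpret constant_domain spire spire_val F by (rule spire_model[OF assms])
  have "insert None (Some ` {d..}) \<union> range Some = UNIV" for d :: nat
    by (auto intro: range_eqI split: option.split)
  then show ?thesis
    using spire_Inter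
    by (intro not_validI[where x = None and e = "\<lambda>_. 0"])
      (simp add: imp_def interior_of_spire spire_val_def)
qed

lemma not_yields_CD: "\<not> yields {GLPOA} CD" "\<not> yields {HE} CD" "\<not> yields {DGP} CD"
proof -
  have F: "openin spire UNIV" by (simp add: openin_spire)
  interpret constant_domain spire spire_val UNIV by (rule spire_model[OF F])
  show "\<not> yields {GLPOA} CD" "\<not> yields {HE} CD" "\<not> yields {DGP} CD"
    by (rule not_yields[OF _ _ spire_not_CD[OF F]];
        (rule valid_GLPOA spire_valid[OF F] | simp); (assumption | simp)?)+
qed

text \<open>
  Falsum is true except at the limit point.  Thus a formula is negated at this point exactly if it
  fails there, and LEM holds; every \<open>P d\<close> is true there, while \<open>\<forall>P\<close> is not.
\<close>

lemma not_yields_DNSU: "\<not> yields {HE} DNSU" "\<not> yields {DGP} DNSU" "\<not> yields {LEM} DNSU"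
proof -
  have F: "openin spire (range Some)" by (auto simp: openin_spire)
  interpret constant_domain spire spire_val "range Some" by (rule spire_model[OF F])
  have LEM: "valid A" if "A \<in> instances LEM" for A
  proof (rule valid_LEM[OF _ that])
    show "x \<in> S \<or> x \<in> imp S (range Some)" for S x
      by (cases x) (simp_all add: imp_def interior_of_spire)
  qed
  have *: "\<not> valid (\<^bold>\<forall>(\<^bold>\<not>(\<^bold>\<not>(Rel 0 [0]))) \<^bold>\<rightarrow> \<^bold>\<not>(\<^bold>\<not>(\<^bold>\<forall>(Rel 0 [0]))))"
  proof -
    have 1: "imp (imp (insert None (Some ` {d..})) (range Some)) (range Some) = UNIV" for d
    proof -
      have "imp (insert None (Some ` {d..})) (range Some) = range Some"
      proof (rule set_eqI)
        show "x \<in> imp (insert None (Some ` {d..})) (range Some) \<longleftrightarrow> x \<in> range Some" for x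
          by (cases x) (simp_all add: imp_def interior_of_spire)
      qed
      then show ?thesis using interior_of_topspace[of spire] by (simp add: imp_def topspace_spire)
    qed
    have 2: "None \<notin> imp (imp {} (range Some)) (range Some)"
      using interior_of_topspace[of spire] by (simp add: imp_def topspace_spire interior_of_spire)
    show ?thesis
      by (rule not_validI[where x = None and e = "\<lambda>_. 0"])
       (use 1 2 spire_Inter in \<open>simp add: imp_def spire_val_def interior_of_spire\<close>)
  qed
  show "\<not> yields {HE} DNSU" "\<not> yields {DGP} DNSU" "\<not> yields {LEM} DNSU"
    by (rule not_yields[OF _ _ *];
        (rule LEM spire_valid[OF F] | simp); (assumption | simp)?)+
qed

section \<open>The hierarchy\<close>

abbreviation (input) edges :: "(scheme \<times> scheme) set" where
  "edges \<equiv> {(LEM, GLPO), (GLPO, LEM), (DNSU, WGMP), (WGMP, DNSU),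
               (DP, GMP), (DP, CD), (GLPOA, GMP), (GLPOA, LEM),
               (GMP, DNSE), (GMP, DNSU), (HE, DNSE), (LEM, DNSE),
               (LEM, WLEM), (DGP, WLEM)}"

lemma yields_edge: "(S, T) \<in> edges \<Longrightarrow> yields {S} T"
  by (simp only: insert_iff empty_iff prod.inject, elim disjE conjE FalseE; simp only:
      yields_LEM_GLPO yields_GLPO_LEM yields_DNSU_WGMP yields_WGMP_DNSU yields_DP_GMP
      yields_DP_CD yields_GLPOA_GMP yields_GLPOA_LEM yields_GMP_DNSE yields_GMP_DNSU
      yields_HE_DNSE yields_LEM_DNSE yields_LEM_WLEM yields_DGP_WLEM)

lemma yields_edges_rtrancl: "(S, T) \<in> edges\<^sup>* \<Longrightarrow> yields {S} T"
proof (induction rule: rtrancl_induct)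
  case base
  show ?case by (rule yields_singletonI) (rule Axiom)
next
  case (step T U)
  show ?case by (rule yields_trans[OF step.IH yields_edge[OF step.hyps(2)]])
qed

abbreviation (input) separations :: "(scheme \<times> scheme) set" where
  "separations \<equiv> {(GLPOA, CD), (GLPOA, HE), (GLPOA, DGP), (DP, WLEM), (HE, WLEM),
    (DP, HE), (CD, DNSU), (HE, DNSU), (LEM, DNSU), (DGP, DNSU), (HE, CD), (DGP, CD),
    (CD, DNSE), (DNSU, DNSE), (DGP, DNSE)}"

lemma not_yields_separation: "(S, T) \<in> separations \<Longrightarrow> \<not> yields {S} T"
  by (simp only: insert_iff empty_iff prod.inject, elim disjE conjE FalseE; simp only:
      not_yields_GLPOA_HE_DGP not_yields_WLEM not_yields_DNSE not_yields_CD_DNSU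
      not_yields_DP_HE not_yields_DGP_DNSE not_yields_CD not_yields_DNSU not_False_eq_True)

text \<open>
  A derivation of \<open>T\<close> from \<open>S\<close> extends on both sides along the arrows, so it is refuted as soon as
  some separation lies above \<open>S\<close> and below \<open>T\<close>.  The separations are chosen such that this
  happens for every pair outside the closure.
\<close>

lemma edges_rtrancl_or_separated:
  "(S, T) \<in> edges\<^sup>* \<or> (\<exists>(S', T') \<in> separations. (S', S) \<in> edges\<^sup>* \<and> (T, T') \<in> edges\<^sup>*)"
proof -
  let ?r = "edges\<^sup>*"
  have e: "(LEM, GLPO) \<in> ?r" "(GLPO, LEM) \<in> ?r" "(DNSU, WGMP) \<in> ?r" "(WGMP, DNSU) \<in> ?r"
    "(DP, GMP) \<in> ?r" "(DP, CD) \<in> ?r" "(GLPOA, GMP) \<in> ?r" "(GLPOA, LEM) \<in> ?r"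
    "(GMP, DNSE) \<in> ?r" "(GMP, DNSU) \<in> ?r" "(HE, DNSE) \<in> ?r" "(LEM, DNSE) \<in> ?r"
    "(LEM, WLEM) \<in> ?r" "(DGP, WLEM) \<in> ?r"
    by (rule r_into_rtrancl, simp)+
  have t: "(DP, DNSE) \<in> ?r" "(DP, DNSU) \<in> ?r" "(GLPOA, DNSE) \<in> ?r" "(GLPOA, DNSU) \<in> ?r"
    "(GLPOA, GLPO) \<in> ?r" "(GLPOA, WLEM) \<in> ?r" "(GMP, WGMP) \<in> ?r"
    "(GLPO, DNSE) \<in> ?r" "(GLPO, WLEM) \<in> ?r"
    by (meson e rtrancl_trans)+
  have t': "(DP, WGMP) \<in> ?r" "(GLPOA, WGMP) \<in> ?r"
    by (meson e t rtrancl_trans)+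
  show ?thesis
    by (cases S; cases T; simp only: bex_simps split_beta fst_conv snd_conv;
        simp only: e t t' rtrancl.rtrancl_refl simp_thms)
qed

theorem mainTheorem1:
  fixes S T :: scheme
  shows "yields {S} T \<longleftrightarrow>
    (S, T) \<in> {(LEM, GLPO), (GLPO, LEM), (DNSU, WGMP), (WGMP, DNSU),
               (DP, GMP), (DP, CD), (GLPOA, GMP), (GLPOA, LEM),
               (GMP, DNSE), (GMP, DNSU), (HE, DNSE), (LEM, DNSE),
               (LEM, WLEM), (DGP, WLEM)}\<^sup>*"
proof
  assume "yields {S} T"
  show "(S, T) \<in> edges\<^sup>*"
  proof (rule ccontr)
    assume "(S, T) \<notin> edges\<^sup>*"
    with edges_rtrancl_or_separated[of S T] obtain S' T' where
      sep: "(S', T') \<in> separations"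
      and "(S', S) \<in> edges\<^sup>*" "(T, T') \<in> edges\<^sup>*"
      by blast
    then have "yields {S'} T'"
      using \<open>yields {S} T\<close> yields_edges_rtrancl yields_trans by metis
    moreover have "\<not> yields {S'} T'"
      using sep by (rule not_yields_separation)
    ultimately show False by simp
  qed
qed (rule yields_edges_rtrancl)

end
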